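(* Suppose that every bipartite dHp graph $G$ with sides $A$ and $B$, both infinite, in which every vertex of $A$ has finite degree and in which for each $v\in B$ either $N(v)$ is finite or $N(v)=A\setminus F_v$ for some finite $F_v\subset A$, admits a double ray $A$-cover. Then every finite bipartite dHp graph $M$ with sides $X$ and $Y$ contains a path covering all the vertices of $X$.
   Context: For $X\subseteq V(G)$ with $|X|\ge 2$, $N^2(X)$ denotes the set of vertices of $G$ having at least two neighbours in $X$. A bipartite graph $G$ with sides $A$ and $B$ is a dHp graph if $|A|\ge 2$ and $|N^2(X)|\ge |X|$ for every $X\subseteq A$ with $|X|\ge 2$. A double ray is a two-way infinite path. A double ray $A$-cover of $G$ is a family of pairwise vertex-disjoint double rays in $G$ such that every vertex of $A$ lies on one of them. A path covering $X$ is a path $P$ in $M$ with $X\subseteq V(P)$. *)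

theory Defs
  imports Main "HOL-Library.Equipollence" "HOL-Library.Infinite_Typeclass"
begin

text \<open>
  A simple bipartite graph is given by its sides \<open>A\<close>, \<open>B\<close> and a set \<open>E\<close> of two-element edges;
  its vertex set is \<open>A \<union> B\<close>, and sides as well as edges may be infinite.
\<close>

definition bipartite_graph :: "'a set \<Rightarrow> 'a set \<Rightarrow> 'a set set \<Rightarrow> bool" where
  "bipartite_graph A B E \<longleftrightarrow>
     A \<inter> B = {} \<and> (\<forall>e\<in>E. \<exists>a\<in>A. \<exists>b\<in>B. e = {a, b})"

definition nbhd :: "'a set set \<Rightarrow> 'a \<Rightarrow> 'a set" where
  "nbhd E v = {w. {v, w} \<in> E}"

text \<open>The disjunct \<open>infinite X\<close> is needed because \<open>card\<close> is \<open>0\<close> on infinite sets.\<close>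

definition at_least_two :: "'a set \<Rightarrow> bool" where
  "at_least_two X \<longleftrightarrow> infinite X \<or> 2 \<le> card X"

definition nbhd2 :: "'a set \<Rightarrow> 'a set set \<Rightarrow> 'a set \<Rightarrow> 'a set" where
  "nbhd2 V E X = {v \<in> V. at_least_two (nbhd E v \<inter> X)}"

text \<open>
  \<open>X\<close> ranges over finite and infinite subsets of \<open>A\<close>, so sizes are compared as cardinals.
\<close>

definition dHp :: "'a set \<Rightarrow> 'a set \<Rightarrow> 'a set set \<Rightarrow> bool" where
  "dHp A B E \<longleftrightarrow>
     bipartite_graph A B E \<and> at_least_two A \<and>
     (\<forall>X\<subseteq>A. at_least_two X \<longrightarrow> X \<lesssim> nbhd2 (A \<union> B) E X)"

definition path_in :: "'a set \<Rightarrow> 'a set set \<Rightarrow> 'a list \<Rightarrow> bool" where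
  "path_in V E p \<longleftrightarrow>
     p \<noteq> [] \<and> set p \<subseteq> V \<and> distinct p \<and> successively (\<lambda>u v. {u, v} \<in> E) p"

definition double_ray :: "'a set \<Rightarrow> 'a set set \<Rightarrow> (int \<Rightarrow> 'a) \<Rightarrow> bool" where
  "double_ray V E r \<longleftrightarrow> range r \<subseteq> V \<and> inj r \<and> (\<forall>i. {r i, r (i + 1)} \<in> E)"

text \<open>
  Two parametrisations of the same double ray have equal ranges, so pairwise disjointness allows
  at most one parametrisation of each double ray in \<open>R\<close>.
\<close>

definition double_ray_cover :: "'a set \<Rightarrow> 'a set \<Rightarrow> 'a set set \<Rightarrow> (int \<Rightarrow> 'a) set \<Rightarrow> bool" where
  "double_ray_cover A B E R \<longleftrightarrow>
     (\<forall>r\<in>R. double_ray (A \<union> B) E r) \<and>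
     pairwise (\<lambda>r s. disjnt (range r) (range s)) R \<and>
     (\<forall>a\<in>A. \<exists>r\<in>R. a \<in> range r)"

end

theory Submission imports Defs begin

text \<open>
  Glue \<open>M\<close> to an infinite graph through two vertices only: add vertices \<open>\<alpha> n\<close> on the side of \<open>X\<close>
  and \<open>\<beta> k\<close> on the side of \<open>Y\<close>, join \<open>\<beta> k\<close> to \<open>\<alpha> n\<close> whenever \<open>k \<le> n + 2\<close>, and join \<open>\<beta> 0\<close> and
  \<open>\<beta> 1\<close> to all of \<open>X\<close>. A set of \<open>m \<ge> 1\<close> of the vertices \<open>\<alpha> n\<close>, together with at least one further
  vertex, has \<open>\<beta> 0, \<dots>, \<beta> m\<close> among its second neighbours, which yields the dHp property.
  A double ray through a vertex of the finite graph \<open>M\<close> has to leave \<open>M\<close> in both directions, and it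
  can do so only into \<open>\<beta> 0\<close> at one end and into \<open>\<beta> 1\<close> at the other. Since the double rays
  of a cover are disjoint, all vertices of \<open>X\<close> therefore lie on one and the same segment, between
  \<open>\<beta> 0\<close> and \<open>\<beta> 1\<close>, of a single double ray; this segment is the required path.
\<close>

section \<open>Sets with at least two elements, and injective sequences leaving finite sets\<close>

lemma at_least_two_iff: "at_least_two S \<longleftrightarrow> (\<exists>p\<in>S. \<exists>q\<in>S. p \<noteq> q)"
proof (cases "finite S")
  case True
  then show ?thesis
    using card_le_Suc0_iff_eq[OF True] by (auto simp: at_least_two_def)
next
  case False
  then obtain p where "p \<in> S"
    by fastforce
  moreover obtain q where "q \<in> S - {p}"
    using infinite_remove[OF False] infinite_imp_nonempty by blast
  ultimately show ?thesis
    using False by (auto simp: at_least_two_def)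
qed

lemma at_least_two_image:
  "inj_on g S \<Longrightarrow> at_least_two (g ` S) \<longleftrightarrow> at_least_two S"
  by (simp add: at_least_two_def card_image finite_image_iff)

lemma at_least_two_mono: "at_least_two S \<Longrightarrow> S \<subseteq> T \<Longrightarrow> at_least_two T"
  by (auto simp: at_least_two_iff)

text \<open>An injective sequence cannot stay in the finite set \<open>U\<close> forever; minimality
  of the first exit puts everything before it inside \<open>U\<close>.\<close>

lemma inj_exits_finite:
  fixes r :: "int \<Rightarrow> 'a"
  assumes "inj r" "finite U" "r i \<in> U"
  obtains h where "i \<le> h" "r ` {i..h} \<subseteq> U" "r (h + 1) \<notin> U"
proof -
  have "inj (\<lambda>n. r (i + int n))"
    using assms(1) by (auto intro!: injI dest!: injD)
  then have "infinite (range (\<lambda>n. r (i + int n)))"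
    by (simp add: finite_image_iff)
  then have ex: "\<exists>n. r (i + int n) \<notin> U"
    using assms(2) by (meson finite_subset image_subsetI)
  define n where "n = (LEAST n. r (i + int n) \<notin> U)"
  have n: "r (i + int n) \<notin> U"
    unfolding n_def using ex by (rule LeastI_ex)
  have small: "r (i + int k) \<in> U" if "k < n" for k
    using that not_less_Least unfolding n_def by blast
  have "n \<noteq> 0"
    using n assms(3) by (metis add.right_neutral of_nat_0)
  show ?thesis
  proof (rule that[of "i + int n - 1"])
    show "i \<le> i + int n - 1"
      using \<open>n \<noteq> 0\<close> by simp
    show "r (i + int n - 1 + 1) \<notin> U"
      using n by simp
    show "r ` {i..i + int n - 1} \<subseteq> U"
    proof (rule image_subsetI)
      fix j assume "j \<in> {i..i + int n - 1}"
      then have "j = i + int (nat (j - i))" "nat (j - i) < n"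
        by auto
      then show "r j \<in> U"
        using small by metis
    qed
  qed
qed

lemma inj_segment_in_finite:
  fixes r :: "int \<Rightarrow> 'a"
  assumes "inj r" "finite U" "r i \<in> U"
  obtains l h where "l \<le> i" "i \<le> h" "r ` {l..h} \<subseteq> U" "r (l - 1) \<notin> U" "r (h + 1) \<notin> U"
proof -
  obtain h where h: "i \<le> h" "r ` {i..h} \<subseteq> U" "r (h + 1) \<notin> U"
    using assms by (rule inj_exits_finite)
  \<comment> \<open>The left end comes from the reversed sequence, started at \<open>- i\<close>;
    its last index \<open>l\<close> inside \<open>U\<close> corresponds to position
    \<open>- l\<close> of \<open>r\<close>.\<close>
  have "inj (\<lambda>j. r (- j))" "r (- (- i)) \<in> U"
    using assms by (auto intro!: injI dest!: injD)
  then obtain l where l: "- i \<le> l" "(\<lambda>j. r (- j)) ` {- i..l} \<subseteq> U" "r (- (l + 1)) \<notin> U"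
    using assms(2) by (elim inj_exits_finite)
  have "r j \<in> U" if "j \<in> {- l..h}" for j
  proof (cases "j \<le> i")
    case True
    then have "- j \<in> {- i..l}"
      using that by auto
    then have "r (- (- j)) \<in> U"
      using l(2) by blast
    then show ?thesis by simp
  next
    case False
    then show ?thesis
      using that h(2) by auto
  qed
  then have "r ` {- l..h} \<subseteq> U"
    by blast
  then show ?thesis
    using that[of "- l" h] h l by simp
qed

lemma successively_map_upto:
  "(\<And>j. l \<le> j \<Longrightarrow> j < h \<Longrightarrow> P (g j) (g (j + 1))) \<Longrightarrow> successively P (map g [l..h])"
proof (induction l h rule: upto.induct)
  case (1 l h)
  show ?case
  proof (cases "l < h")
    case True
    have "successively P (map g [l + 1..h])"
      using True by (intro "1.IH" "1.prems") simp_all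
    moreover have "P (g l) (g (l + 1))"
      using True by (intro "1.prems") simp_all
    ultimately show ?thesis
      using True by (simp add: upto_rec1[of l h] upto_rec1[of "l + 1" h])
  next
    case False
    then show ?thesis
      by (cases "l = h") auto
  qed
qed

section \<open>The extended graph and its neighbourhoods\<close>

locale finite_bipartite_extension =
  fixes X Y :: "'b set" and M :: "'b set set"
    and f :: "'b \<Rightarrow> 'a" and \<alpha> \<beta> :: "nat \<Rightarrow> 'a"
  assumes dHp_M: "dHp X Y M" and fin: "finite X" "finite Y"
    and inj_f: "inj_on f (X \<union> Y)" and inj_\<alpha>: "inj \<alpha>" and inj_\<beta>: "inj \<beta>"
    and disjoint: "f ` (X \<union> Y) \<inter> range \<alpha> = {}" "f ` (X \<union> Y) \<inter> range \<beta> = {}"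
      "range \<alpha> \<inter> range \<beta> = {}"
begin

lemma f_\<alpha>: "x \<in> X \<union> Y \<Longrightarrow> f x \<noteq> \<alpha> n"
  and f_\<beta>: "x \<in> X \<union> Y \<Longrightarrow> f x \<noteq> \<beta> n"
  and \<alpha>_\<beta>: "\<alpha> n \<noteq> \<beta> k"
  using disjoint by (metis disjoint_iff imageI rangeI)+

text \<open>The map \<open>f\<close> copies \<open>M\<close> into the type of the infinite graph,
  which may differ from the vertex type of \<open>M\<close>.\<close>

definition A where "A = f ` X \<union> range \<alpha>"
definition B where "B = f ` Y \<union> range \<beta>"
text \<open>The condition \<open>k \<le> n + 2\<close> gives every \<open>\<alpha> n\<close> finite
  degree and lets every \<open>\<beta> k\<close> miss only finitely many \<open>\<alpha> n\<close>.
  The offset 2 makes m of the \<open>\<alpha> n\<close>, for m at least 2, share m + 1 second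
  neighbours.\<close>

definition G where
  "G = (`) f ` M \<union> {{f x, \<beta> k} | x k. x \<in> X \<and> k < 2} \<union> {{\<alpha> n, \<beta> k} | n k. k \<le> n + 2}"

lemma bip_M: "bipartite_graph X Y M"
  using dHp_M by (simp add: dHp_def)

lemma M_subset: "e \<in> M \<Longrightarrow> e \<subseteq> X \<union> Y"
  using bip_M by (auto simp: bipartite_graph_def)

lemma G_cases:
  assumes "e \<in> G"
  obtains d where "d \<in> M" "f ` d = e" | x k where "k < 2" "x \<in> X" "e = {f x, \<beta> k}"
    | n k where "k \<le> n + 2" "e = {\<alpha> n, \<beta> k}"
  using assms unfolding G_def by blast

lemma bip_G: "bipartite_graph A B G"
proof -
  have "A \<inter> B = {}"
  proof -
    have "f ` X \<inter> f ` Y = f ` (X \<inter> Y)"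
      using inj_f by (auto dest: inj_onD)
    then have "f ` X \<inter> f ` Y = {}"
      using bip_M by (simp add: bipartite_graph_def)
    moreover have "f ` X \<inter> range \<beta> = {}"
      using f_\<beta> by auto
    moreover have "range \<alpha> \<inter> f ` Y = {}"
      using f_\<alpha> by (metis UnCI disjoint_iff imageE)
    moreover have "range \<alpha> \<inter> range \<beta> = {}"
      using \<alpha>_\<beta> by auto
    ultimately show ?thesis
      by (simp add: A_def B_def Int_Un_distrib Int_Un_distrib2)
  qed
  moreover have "\<exists>a\<in>A. \<exists>b\<in>B. e = {a, b}" if "e \<in> G" for e
    using that
  proof (cases rule: G_cases)
    case (1 d)
    then obtain x y where "x \<in> X" "y \<in> Y" "d = {x, y}"
      using bip_M unfolding bipartite_graph_def by blast
    then have "f x \<in> A" "f y \<in> B" "e = {f x, f y}"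
      using 1 by (auto simp: A_def B_def)
    then show ?thesis
      by blast
  next
    case (2 x k)
    then have "f x \<in> A" "\<beta> k \<in> B"
      by (auto simp: A_def B_def)
    then show ?thesis
      using 2 by blast
  next
    case (3 n k)
    have "\<alpha> n \<in> A" "\<beta> k \<in> B"
      by (auto simp: A_def B_def)
    then show ?thesis
      using 3 by blast
  qed
  ultimately show ?thesis
    by (simp add: bipartite_graph_def)
qed

text \<open>Each edge of \<open>G\<close> outside the copy of \<open>M\<close> contains some
  \<open>\<beta> k\<close>, so copying adds no edge between copied vertices; injectivity of
  \<open>f\<close> then recovers the edge of \<open>M\<close>.\<close>

lemma edge_M:
  assumes "p \<in> X \<union> Y" "q \<in> X \<union> Y"
  shows "{f p, f q} \<in> G \<longleftrightarrow> {p, q} \<in> M"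
proof
  assume "{f p, f q} \<in> G"
  then obtain e where "e \<in> M" "f ` e = f ` {p, q}"
  proof (cases rule: G_cases)
    case (2 x k)
    then show ?thesis
      using f_\<beta> assms by (metis doubleton_eq_iff)
  next
    case (3 n k)
    then show ?thesis
      using f_\<beta> assms by (metis doubleton_eq_iff)
  qed (use that in simp)
  then have "e = {p, q}"
    using inj_f M_subset assms by (metis insert_subset empty_subsetI inj_on_image_eq_iff)
  then show "{p, q} \<in> M"
    using \<open>e \<in> M\<close> by simp
next
  assume "{p, q} \<in> M"
  then have "f ` {p, q} \<in> G"
    unfolding G_def by blast
  then show "{f p, f q} \<in> G"
    by simp
qed

text \<open>The bottleneck of the construction: the copy of \<open>M\<close> can be left only
  through \<open>\<beta> 0\<close> and \<open>\<beta> 1\<close>.\<close>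

lemma nbhd_f:
  assumes "p \<in> X \<union> Y"
  shows "nbhd G (f p) \<subseteq> f ` (X \<union> Y) \<union> {\<beta> 0, \<beta> 1}"
proof
  fix z assume "z \<in> nbhd G (f p)"
  then have "{f p, z} \<in> G"
    by (simp add: nbhd_def)
  then show "z \<in> f ` (X \<union> Y) \<union> {\<beta> 0, \<beta> 1}"
  proof (cases rule: G_cases)
    case (1 d)
    then show ?thesis
      using M_subset by blast
  next
    case (2 x k)
    then have "z = \<beta> k"
      using assms f_\<beta> by (auto simp: doubleton_eq_iff)
    then show ?thesis
      using \<open>k < 2\<close> by (auto simp: less_2_cases_iff)
  next
    case (3 n k)
    then show ?thesis
      using assms f_\<alpha> f_\<beta> by (auto simp: doubleton_eq_iff)
  qed
qed

lemma nbhd_\<beta>: "nbhd G (\<beta> k) = (if k < 2 then f ` X else {}) \<union> \<alpha> ` {n. k \<le> n + 2}"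
proof (intro equalityI subsetI)
  fix z assume "z \<in> nbhd G (\<beta> k)"
  then have "{\<beta> k, z} \<in> G"
    by (simp add: nbhd_def)
  then show "z \<in> (if k < 2 then f ` X else {}) \<union> \<alpha> ` {n. k \<le> n + 2}"
  proof (cases rule: G_cases)
    case (1 d)
    then show ?thesis
      using M_subset[OF \<open>d \<in> M\<close>] f_\<beta> by (metis imageE insertI1 subsetD)
  next
    case (2 x j)
    then have "j = k" "z = f x"
      using f_\<beta> inj_\<beta> by (metis UnCI doubleton_eq_iff injD)+
    then show ?thesis
      using 2 by simp
  next
    case (3 n j)
    then have "j = k" "z = \<alpha> n"
      using \<alpha>_\<beta> inj_\<beta> by (metis doubleton_eq_iff injD)+
    then show ?thesis
      using 3 by simp
  qed
next
  fix z assume "z \<in> (if k < 2 then f ` X else {}) \<union> \<alpha> ` {n. k \<le> n + 2}"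
  then consider x where "k < 2" "x \<in> X" "z = f x" | n where "k \<le> n + 2" "z = \<alpha> n"
    by (auto split: if_splits)
  then have "{z, \<beta> k} \<in> G"
    unfolding G_def by cases blast+
  then show "z \<in> nbhd G (\<beta> k)"
    by (simp add: nbhd_def insert_commute)
qed

lemma nbhd_\<alpha>: "nbhd G (\<alpha> n) \<subseteq> \<beta> ` {..n + 2}"
proof
  fix z assume "z \<in> nbhd G (\<alpha> n)"
  then have "{\<alpha> n, z} \<in> G"
    by (simp add: nbhd_def)
  then show "z \<in> \<beta> ` {..n + 2}"
  proof (cases rule: G_cases)
    case (1 d)
    then show ?thesis
      using M_subset[OF \<open>d \<in> M\<close>] f_\<alpha> by (metis imageE insertI1 subsetD)
  next
    case (2 x k)
    then show ?thesis
      using f_\<alpha> \<alpha>_\<beta> by (metis UnCI doubleton_eq_iff)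
  next
    case (3 m k)
    then have "m = n" "z = \<beta> k"
      using \<alpha>_\<beta> inj_\<alpha> by (metis doubleton_eq_iff injD)+
    then show ?thesis
      using 3 by simp
  qed
qed

section \<open>Second neighbourhoods and the dHp property\<close>

lemma nbhd2_f: "X' \<subseteq> X \<Longrightarrow> f ` nbhd2 (X \<union> Y) M X' \<subseteq> nbhd2 (A \<union> B) G (f ` X' \<union> Z)"
proof
  fix v assume X': "X' \<subseteq> X" and "v \<in> f ` nbhd2 (X \<union> Y) M X'"
  then obtain y where y: "v = f y" "y \<in> X \<union> Y" "at_least_two (nbhd M y \<inter> X')"
    by (auto simp: nbhd2_def)
  have "inj_on f (nbhd M y \<inter> X')"
    using inj_f X' by (auto intro: inj_on_subset)
  then have "at_least_two (f ` (nbhd M y \<inter> X'))"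
    using y at_least_two_image by blast
  \<comment> \<open>Copied neighbours remain neighbours; the arbitrary set \<open>Z\<close>, later a
    set of vertices \<open>\<alpha> n\<close>, can only add more.\<close>
  moreover have "f ` (nbhd M y \<inter> X') \<subseteq> nbhd G v \<inter> (f ` X' \<union> Z)"
    using y X' edge_M by (fastforce simp: nbhd_def)
  ultimately have "at_least_two (nbhd G v \<inter> (f ` X' \<union> Z))"
    by (rule at_least_two_mono)
  then show "v \<in> nbhd2 (A \<union> B) G (f ` X' \<union> Z)"
    using y by (auto simp: nbhd2_def A_def B_def)
qed

text \<open>The indices adjacent to \<open>\<beta> k\<close> are those not below
  \<open>k - 2\<close>. Subtraction is truncated, so nothing is removed from \<open>N\<close> when
  \<open>k \<le> 2\<close>.\<close>

lemma \<beta>_nbhd2: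
  assumes "at_least_two (N - {..<k - 2})"
  shows "\<beta> k \<in> nbhd2 (A \<union> B) G (Z \<union> \<alpha> ` N)"
proof -
  have "at_least_two (\<alpha> ` (N - {..<k - 2}))"
    using assms inj_\<alpha> at_least_two_image by (metis inj_on_subset subset_UNIV)
  moreover have "\<alpha> ` (N - {..<k - 2}) \<subseteq> nbhd G (\<beta> k) \<inter> (Z \<union> \<alpha> ` N)"
    unfolding nbhd_\<beta> by auto
  ultimately have "at_least_two (nbhd G (\<beta> k) \<inter> (Z \<union> \<alpha> ` N))"
    by (rule at_least_two_mono)
  then show ?thesis
    by (auto simp: nbhd2_def B_def)
qed

text \<open>The left side is countable because \<open>X'\<close> is finite, while an infinite
  \<open>N\<close> keeps infinitely many indices beyond any bound, so every \<open>\<beta> k\<close>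
  is a second neighbour.\<close>

lemma lepoll_nbhd2_infinite:
  assumes "X' \<subseteq> X" "infinite N"
  shows "f ` X' \<union> \<alpha> ` N \<lesssim> nbhd2 (A \<union> B) G (f ` X' \<union> \<alpha> ` N)"
proof -
  have "finite X'"
    using assms fin finite_subset by blast
  then have "countable (f ` X' \<union> \<alpha> ` N)"
    by (simp add: countable_finite)
  then have "f ` X' \<union> \<alpha> ` N \<lesssim> (UNIV :: nat set)"
    by (auto simp: countable_def lepoll_def)
  also have "(UNIV :: nat set) \<lesssim> range \<beta>"
    unfolding lepoll_def using inj_\<beta> by blast
  also have "range \<beta> \<lesssim> nbhd2 (A \<union> B) G (f ` X' \<union> \<alpha> ` N)"
    using assms by (intro subset_imp_lepoll image_subsetI \<beta>_nbhd2) (simp add: at_least_two_def)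
  finally show ?thesis .
qed

text \<open>If \<open>N\<close> has at least two elements and \<open>k \<le> card N\<close>, then
  removing the indices below \<open>k - 2\<close> leaves at least two. If \<open>N\<close> is a
  singleton, only \<open>\<beta> 0\<close> and \<open>\<beta> 1\<close> occur, and these also see
  all of \<open>X'\<close>.\<close>

lemma \<beta>_nbhd2_finite:
  assumes "X' \<subseteq> X" "finite N" "N \<noteq> {}" "X' \<noteq> {} \<or> 2 \<le> card N"
  shows "\<beta> ` {..card N} \<subseteq> nbhd2 (A \<union> B) G (f ` X' \<union> \<alpha> ` N)"
proof (rule image_subsetI)
  fix k assume "k \<in> {..card N}"
  show "\<beta> k \<in> nbhd2 (A \<union> B) G (f ` X' \<union> \<alpha> ` N)"
  proof (cases "2 \<le> card N")
    case True
    have "card N - (k - 2) \<le> card (N - {..<k - 2})"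
      using diff_card_le_card_Diff[of "{..<k - 2}" N] by simp
    then show ?thesis
      using True \<open>k \<in> {..card N}\<close> by (intro \<beta>_nbhd2) (auto simp: at_least_two_def)
  next
    case False
    then have "card N = 1"
      using assms card_0_eq[of N] by linarith
    then have "k < 2"
      using \<open>k \<in> {..card N}\<close> by simp
    obtain x n where "x \<in> X'" "n \<in> N"
      using assms False by auto
    then have "f x \<in> nbhd G (\<beta> k) \<inter> (f ` X' \<union> \<alpha> ` N)"
      "\<alpha> n \<in> nbhd G (\<beta> k) \<inter> (f ` X' \<union> \<alpha> ` N)" "f x \<noteq> \<alpha> n"
      using \<open>k < 2\<close> assms(1) f_\<alpha> by (auto simp: nbhd_\<beta>)
    then have "at_least_two (nbhd G (\<beta> k) \<inter> (f ` X' \<union> \<alpha> ` N))"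
      unfolding at_least_two_iff by blast
    then show ?thesis
      by (auto simp: nbhd2_def B_def)
  qed
qed

text \<open>Two disjoint supplies of second neighbours are counted: those inherited from
  \<open>M\<close>, at least \<open>card X'\<close> many once \<open>X'\<close> has two elements,
  and, for nonempty \<open>N\<close>, \<open>card N + 1\<close> vertices
  \<open>\<beta> k\<close>.\<close>

lemma lepoll_nbhd2_finite:
  assumes X': "X' \<subseteq> X" and N: "finite N" and two: "at_least_two (f ` X' \<union> \<alpha> ` N)"
  shows "f ` X' \<union> \<alpha> ` N \<lesssim> nbhd2 (A \<union> B) G (f ` X' \<union> \<alpha> ` N)" (is "?W \<lesssim> ?N2")
proof -
  have finX': "finite X'"
    using X' fin finite_subset by blast
  have injX': "inj_on f X'"
    using X' inj_f by (auto intro: inj_on_subset)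
  have "f ` X' \<inter> \<alpha> ` N = {}"
    using X' f_\<alpha> by blast
  then have cardW: "card ?W = card X' + card N"
    using finX' N injX' inj_\<alpha> by (simp add: card_Un_disjoint card_image inj_on_subset)
  have two': "2 \<le> card X' + card N"
    using two finX' N cardW by (auto simp: at_least_two_def)
  define S where "S = nbhd2 (X \<union> Y) M X'"
  have "S \<subseteq> X \<union> Y"
    by (auto simp: S_def nbhd2_def)
  then have finS: "finite S" and injS: "inj_on f S"
    using fin inj_f by (auto intro: finite_subset inj_on_subset)
  have cardS: "card X' \<le> card S" if "2 \<le> card X'"
  proof -
    have "X' \<lesssim> S"
      using dHp_M X' that by (auto simp: dHp_def at_least_two_def S_def)
    then show ?thesis
      using lepoll_iff_card_le[OF finX' finS] by blast
  qed
  have fS: "f ` S \<subseteq> ?N2"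
    unfolding S_def using X' by (rule nbhd2_f)
  \<comment> \<open>A large enough finite subset \<open>T\<close> lets \<open>card\<close> stand in
    for \<open>\<lesssim>\<close>, as \<open>card\<close> is 0 on infinite sets.\<close>
  have "\<exists>T\<subseteq>?N2. finite T \<and> card ?W \<le> card T"
  proof (cases "N = {}")
    case True
    then have "card ?W \<le> card (f ` S)"
      using cardS two' cardW injS by (simp add: card_image)
    then show ?thesis
      using fS finS by blast
  next
    case False
    have "card X' \<noteq> 0 \<or> 2 \<le> card N"
      using two' by linarith
    then have \<beta>: "\<beta> ` {..card N} \<subseteq> ?N2"
      using X' N False finX' by (intro \<beta>_nbhd2_finite) auto
    have card\<beta>: "card (\<beta> ` {..card N}) = card N + 1"
      using inj_\<beta> by (simp add: card_image inj_on_subset)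
    have "f ` S \<inter> \<beta> ` {..card N} = {}"
      using f_\<beta> \<open>S \<subseteq> X \<union> Y\<close> by blast
    then have "card (f ` S \<union> \<beta> ` {..card N}) = card S + (card N + 1)"
      using finS injS card\<beta> by (simp add: card_Un_disjoint card_image)
    \<comment> \<open>If \<open>X'\<close> has at most one element, \<open>M\<close> may contribute
      nothing; the one surplus \<open>\<beta> k\<close> makes up for it.\<close>
    then have "card ?W \<le> card (f ` S \<union> \<beta> ` {..card N})"
      using cardW cardS by (cases "2 \<le> card X'") auto
    then show ?thesis
      using fS \<beta> finS by (intro exI[of _ "f ` S \<union> \<beta> ` {..card N}"]) auto
  qed
  then obtain T where T: "T \<subseteq> ?N2" "finite T" "card ?W \<le> card T"
    by blast
  have "?W \<lesssim> T"
    using T finX' N by (subst lepoll_iff_card_le) auto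
  then show ?thesis
    using T subset_imp_lepoll lepoll_trans by blast
qed

lemma infinite_sides: "infinite A" "infinite B"
  using inj_\<alpha> inj_\<beta> by (auto simp: A_def B_def finite_image_iff)

lemma dHp_G: "dHp A B G"
proof -
  have "W \<lesssim> nbhd2 (A \<union> B) G W" if "W \<subseteq> A" "at_least_two W" for W
  proof -
    have "W = f ` {x \<in> X. f x \<in> W} \<union> \<alpha> ` {n. \<alpha> n \<in> W}"
      using that(1) by (auto simp: A_def)
    moreover have "{x \<in> X. f x \<in> W} \<subseteq> X"
      by blast
    ultimately show ?thesis
      using that(2) lepoll_nbhd2_infinite lepoll_nbhd2_finite by metis
  qed
  then show ?thesis
    using bip_G infinite_sides by (simp add: dHp_def at_least_two_def)
qed

section \<open>Degree conditions\<close>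

lemma finite_nbhd_f: "p \<in> X \<union> Y \<Longrightarrow> finite (nbhd G (f p))"
  using nbhd_f fin by (meson finite_UnI finite_imageI finite.intros finite_subset)

lemma finite_nbhd_A: "v \<in> A \<Longrightarrow> finite (nbhd G v)"
  using finite_nbhd_f finite_subset[OF nbhd_\<alpha>] by (auto simp: A_def)

lemma finite_or_cofinite_nbhd_B:
  assumes "v \<in> B"
  shows "finite (nbhd G v) \<or> (\<exists>F. finite F \<and> F \<subset> A \<and> nbhd G v = A - F)"
proof -
  have "\<exists>F. finite F \<and> F \<subset> A \<and> nbhd G (\<beta> k) = A - F" for k
  proof (intro exI conjI)
    have sub: "nbhd G (\<beta> k) \<subseteq> A"
      by (auto simp: nbhd_\<beta> A_def)
    then show "nbhd G (\<beta> k) = A - (A - nbhd G (\<beta> k))"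
      by blast
    \<comment> \<open>One neighbour in \<open>A\<close> suffices to make the exceptional set a
      proper subset of \<open>A\<close>.\<close>
    have "\<alpha> k \<in> nbhd G (\<beta> k)"
      by (auto simp: nbhd_\<beta>)
    then show "A - nbhd G (\<beta> k) \<subset> A"
      using sub by blast
    \<comment> \<open>A crude bound: non-neighbours \<open>\<alpha> n\<close> satisfy
      \<open>n + 2 < k\<close>, hence \<open>n < k\<close>.\<close>
    have "A - nbhd G (\<beta> k) \<subseteq> f ` X \<union> \<alpha> ` {..<k}"
    proof
      fix z assume z: "z \<in> A - nbhd G (\<beta> k)"
      show "z \<in> f ` X \<union> \<alpha> ` {..<k}"
      proof (cases "z \<in> f ` X")
        case False
        then obtain n where "z = \<alpha> n"
          using z by (auto simp: A_def)
        then have "\<not> k \<le> n + 2"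
          using z by (auto simp: nbhd_\<beta>)
        then show ?thesis
          using \<open>z = \<alpha> n\<close> by simp
      qed simp
    qed
    then show "finite (A - nbhd G (\<beta> k))"
      using fin by (meson finite_UnI finite_imageI finite_lessThan finite_subset)
  qed
  then show ?thesis
    using assms finite_nbhd_f by (auto simp: B_def)
qed

section \<open>From a double ray cover to a path in \<open>M\<close>\<close>

lemma double_ray_segment:
  assumes r: "double_ray (A \<union> B) G r" and "r i \<in> f ` X"
  obtains l h where "l \<le> i" "i \<le> h" "r ` {l..h} \<subseteq> f ` (X \<union> Y)"
    "{r (l - 1), r (h + 1)} = {\<beta> 0, \<beta> 1}"
proof -
  have "inj r" and edge: "{r j, r (j + 1)} \<in> G" for j
    using r by (auto simp: double_ray_def)
  have "finite (f ` (X \<union> Y))" "r i \<in> f ` (X \<union> Y)"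
    using fin assms(2) by auto
  \<comment> \<open>The maximal stretch of the ray around \<open>i\<close> inside the finite copy of
    \<open>M\<close>; the positions \<open>l - 1\<close> and \<open>h + 1\<close> are its
    exits.\<close>
  then obtain l h where lh: "l \<le> i" "i \<le> h" "r ` {l..h} \<subseteq> f ` (X \<union> Y)"
    "r (l - 1) \<notin> f ` (X \<union> Y)" "r (h + 1) \<notin> f ` (X \<union> Y)"
    using \<open>inj r\<close> by (elim inj_segment_in_finite)
  then have "r l \<in> f ` (X \<union> Y)" "r h \<in> f ` (X \<union> Y)"
    by auto
  moreover have "r (l - 1) \<in> nbhd G (r l)" "r (h + 1) \<in> nbhd G (r h)"
    using edge[of "l - 1"] edge[of h] by (auto simp: nbhd_def insert_commute)
  moreover have "z \<in> {\<beta> 0, \<beta> 1}"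
    if "v \<in> f ` (X \<union> Y)" "z \<in> nbhd G v" "z \<notin> f ` (X \<union> Y)" for v z
  proof -
    obtain p where "p \<in> X \<union> Y" "v = f p"
      using \<open>v \<in> f ` (X \<union> Y)\<close> by (rule imageE)
    then show ?thesis
      using nbhd_f[of p] that(2,3) by (meson UnE subsetD)
  qed
  ultimately have "r (l - 1) \<in> {\<beta> 0, \<beta> 1}" "r (h + 1) \<in> {\<beta> 0, \<beta> 1}"
    using lh(4,5) by metis+
  \<comment> \<open>A ray visits each vertex once, so the two exits use up both
    \<open>\<beta> 0\<close> and \<open>\<beta> 1\<close>.\<close>
  moreover have "r (l - 1) \<noteq> r (h + 1)"
    using \<open>inj r\<close> lh by (auto dest: injD)
  ultimately have "{r (l - 1), r (h + 1)} = {\<beta> 0, \<beta> 1}"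
    by auto
  then show ?thesis
    using that lh by blast
qed

lemma path_of_segment:
  assumes r: "double_ray (A \<union> B) G r" and "l \<le> h" and seg: "r ` {l..h} \<subseteq> f ` (X \<union> Y)"
    and cover: "f ` X \<subseteq> r ` {l..h}"
  shows "\<exists>p. path_in (X \<union> Y) M p \<and> X \<subseteq> set p"
proof -
  \<comment> \<open>The segment is pulled back along \<open>f\<close>; as it stays inside the copy,
    \<open>edge_M\<close> turns its edges into edges of \<open>M\<close>.\<close>
  define g where "g j = inv_into (X \<union> Y) f (r j)" for j
  have g: "g j \<in> X \<union> Y" "f (g j) = r j" if "j \<in> {l..h}" for j
    using that seg inv_into_into[of "r j" f "X \<union> Y"] f_inv_into_f[of "r j" f "X \<union> Y"]
    unfolding g_def by blast+
  have "inj_on g {l..h}"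
    using r g(2) unfolding double_ray_def inj_on_def by (metis UNIV_I)
  moreover have "{g j, g (j + 1)} \<in> M" if "l \<le> j" "j < h" for j
    using r that g[of j] g[of "j + 1"] edge_M[of "g j" "g (j + 1)"] by (auto simp: double_ray_def)
  then have "successively (\<lambda>u v. {u, v} \<in> M) (map g [l..h])"
    by (rule successively_map_upto)
  moreover have "set (map g [l..h]) \<subseteq> X \<union> Y"
    using g(1) by (simp add: image_subset_iff)
  ultimately have "path_in (X \<union> Y) M (map g [l..h])"
    using \<open>l \<le> h\<close> by (simp add: path_in_def distinct_map)
  moreover have "X \<subseteq> set (map g [l..h])"
  proof
    fix x assume "x \<in> X"
    then obtain j where "j \<in> {l..h}" "f x = r j"
      using cover by blast
    then have "g j = x"
      using \<open>x \<in> X\<close> inj_f by (metis UnCI g inj_onD)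
    then show "x \<in> set (map g [l..h])"
      using \<open>j \<in> {l..h}\<close> by auto
  qed
  ultimately show ?thesis
    by blast
qed

lemma path_of_double_ray_cover:
  assumes "double_ray_cover A B G R"
  shows "\<exists>p. path_in (X \<union> Y) M p \<and> X \<subseteq> set p"
proof -
  have ray: "\<exists>r\<in>R. \<exists>i. f x = r i" if "x \<in> X" for x
  proof -
    have "f x \<in> A"
      using that by (simp add: A_def)
    then show ?thesis
      using assms unfolding double_ray_cover_def by (metis imageE)
  qed
  have dr: "double_ray (A \<union> B) G r" if "r \<in> R" for r
    using assms that by (simp add: double_ray_cover_def)
  obtain x where "x \<in> X"
    using dHp_M by (auto simp: dHp_def at_least_two_iff)
  then obtain r i where r: "r \<in> R" "r i = f x"
    using ray by metis
  then obtain l h where lh: "l \<le> i" "i \<le> h" "r ` {l..h} \<subseteq> f ` (X \<union> Y)"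
    "{r (l - 1), r (h + 1)} = {\<beta> 0, \<beta> 1}"
    using dr \<open>x \<in> X\<close> by (metis double_ray_segment imageI)
  have "inj r"
    using dr r by (simp add: double_ray_def)
  have "f z \<in> r ` {l..h}" if "z \<in> X" for z
  proof -
    obtain s j where s: "s \<in> R" "s j = f z"
      using ray \<open>z \<in> X\<close> by metis
    then obtain l' h' where lh': "l' \<le> j" "j \<le> h'" "{s (l' - 1), s (h' + 1)} = {\<beta> 0, \<beta> 1}"
      using dr \<open>z \<in> X\<close> by (metis double_ray_segment imageI)
    \<comment> \<open>Both rays pass through \<open>\<beta> 0\<close>, so disjointness makes them
      equal.\<close>
    have "\<beta> 0 \<in> range r" "\<beta> 0 \<in> range s"
      using lh(4) lh'(3) by (metis insertE insertI1 rangeI singletonD)+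
    then have "s = r"
      using assms r s unfolding double_ray_cover_def pairwise_def disjnt_def by blast
    \<comment> \<open>On the common ray, both pairs of exits sit at the positions of
      \<open>\<beta> 0\<close> and \<open>\<beta> 1\<close>. Since \<open>l - 1 < h + 1\<close> and
      \<open>l' - 1 < h' + 1\<close>, the segments coincide.\<close>
    then have "r ` {l - 1, h + 1} = r ` {l' - 1, h' + 1}"
      using lh lh' by simp
    then have "{l - 1, h + 1} = {l' - 1, h' + 1}"
      using \<open>inj r\<close> by (simp only: inj_image_eq_iff)
    then have "l = l'" "h = h'"
      using lh(1,2) lh'(1,2) by (auto simp: doubleton_eq_iff)
    then show ?thesis
      using s \<open>s = r\<close> lh' by (metis atLeastAtMost_iff imageI)
  qed
  then show ?thesis
    using dr r lh by (intro path_of_segment[of r l h]) auto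
qed

end

section \<open>Realising the extension in an arbitrary infinite type\<close>

lemma ex_disjoint_embeddings:
  assumes "finite (U :: 'b set)"
  obtains f :: "'b \<Rightarrow> 'a::infinite" and \<alpha> \<beta> :: "nat \<Rightarrow> 'a"
  where "inj_on f U" "inj \<alpha>" "inj \<beta>"
    "f ` U \<inter> range \<alpha> = {}" "f ` U \<inter> range \<beta> = {}" "range \<alpha> \<inter> range \<beta> = {}"
proof -
  obtain g :: "nat \<Rightarrow> 'a" where g: "inj g"
    using infinite_countable_subset[OF infinite_UNIV] by auto
  obtain c :: "'b \<Rightarrow> nat" where c: "inj_on c U"
    using finite_imp_inj_to_nat_seg[OF assms] by auto
  have eq: "g m = g n \<longleftrightarrow> m = n" for m n
    using g by (auto dest: injD)
  show ?thesis
  \<comment> \<open>The three residue classes modulo 3 inside a copy of the natural numbers keep the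
    three families of vertices apart.\<close>
  proof (rule that[of "\<lambda>x. g (3 * c x)" "\<lambda>n. g (3 * n + 1)" "\<lambda>n. g (3 * n + 2)"])
    show "inj_on (\<lambda>x. g (3 * c x)) U"
      using c by (auto simp: inj_on_def eq)
    show "inj (\<lambda>n. g (3 * n + 1))" "inj (\<lambda>n. g (3 * n + 2))"
      by (auto simp: inj_def eq)
  qed (auto simp: eq, presburger+)
qed

theorem theorem2p13:
  fixes X Y :: "'b set" and M :: "'b set set"
  assumes "\<And>(A :: 'a::infinite set) (B :: 'a set) (G :: 'a set set).
      \<lbrakk>dHp A B G; infinite A; infinite B;
       \<forall>v\<in>A. finite (nbhd G v);
       \<forall>v\<in>B. finite (nbhd G v) \<or> (\<exists>F. finite F \<and> F \<subset> A \<and> nbhd G v = A - F)\<rbrakk>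
      \<Longrightarrow> \<exists>R. double_ray_cover A B G R"
    and "dHp X Y M" and "finite X" and "finite Y"
  shows "\<exists>p. path_in (X \<union> Y) M p \<and> X \<subseteq> set p"
proof -
  have "finite (X \<union> Y)"
    using assms by simp
  then obtain f :: "'b \<Rightarrow> 'a" and \<alpha> \<beta> :: "nat \<Rightarrow> 'a" where
    "inj_on f (X \<union> Y)" "inj \<alpha>" "inj \<beta>" "f ` (X \<union> Y) \<inter> range \<alpha> = {}"
    "f ` (X \<union> Y) \<inter> range \<beta> = {}" "range \<alpha> \<inter> range \<beta> = {}"
    by (rule ex_disjoint_embeddings)
  then interpret finite_bipartite_extension X Y M f \<alpha> \<beta>
    using assms(2-4) by unfold_locales
  have "\<exists>R. double_ray_cover A B G R"
    by (intro assms(1) ballI dHp_G infinite_sides finite_nbhd_A finite_or_cofinite_nbhd_B)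
  then show ?thesis
    using path_of_double_ray_cover by blast
qed

end
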